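(* The relation on XCCS processes defined by $P\leftrightarrow Q$ iff $\vdash\langle P\rangle p\leftrightarrow\langle Q\rangle p$ (in the XCCS-PDL axiom system) is a congruence, i.e. an equivalence relation preserved by all XCCS operators.
   Context: XCCS processes: $P ::= {\bf 0}\mid END\mid\alpha.P\mid P_1;P_2\mid P_1+P_2\mid P_1|P_2\mid P^*\mid P\backslash L$ ($\alpha ::= a\mid\overline a\mid\tau$; termination $\mathrm{Done}$ only via $END$). XCCS-PDL axiom system: propositional tautologies; (K) $[P](p\to q)\to([P]p\to[P]q)$; (Du) $[P]p\leftrightarrow\neg\langle P\rangle\neg p$; (Pr) $\langle\alpha.P\rangle p\leftrightarrow\langle\alpha\rangle\langle P\rangle p$; (NC) $\langle P_1+P_2\rangle p\leftrightarrow\langle P_1\rangle p\lor\langle P_2\rangle p$; (PC) if $P=P_1|P_2$ is unrestricted and $|$ does not occur in $P_1,P_2$, then $\langle P\rangle p\leftrightarrow\langle Exp(P)\rangle p$, where $Exp(P)=\sum_{P_1\stackrel{\alpha}{\to}P_1'}\alpha.(P_1'|P_2)+\sum_{P_2\stackrel{\beta}{\to}P_2'}\beta.(P_1|P_2')+\sum\tau.(P_1'|P_2')+E_P$ (third sum over complementary-action pairs; $E_P=END$ if both $P_i\stackrel{END}{\to}\mathrm{Done}$, else ${\bf 0}$); (0) $\neg\langle{\bf 0}\rangle p$; (END) $\langle END\rangle p\leftrightarrow p$; (SC) $\langle P_1;P_2\rangle p\leftrightarrow\langle P_1\rangle\langle P_2\rangle p$; (Rec) $\langle P^*\rangle p\leftrightarrow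 p\lor\langle P\rangle\langle P^*\rangle p$; (FP) $p\land[P^*](p\to[P]p)\to[P^*]p$; rules Substitution, Modus Ponens, Generalization; (PCSub) from $\vdash\langle P\rangle p\leftrightarrow\langle Q\rangle p$ infer $\vdash\langle P|R\rangle p\leftrightarrow\langle Q|R\rangle p$; (RSub) likewise for $P\backslash L$, $Q\backslash L$; (Ard) if $\vdash\langle P\rangle p\leftrightarrow\langle A;P+B\rangle p$ and $A$ cannot perform $END$ to $\mathrm{Done}$, then $\vdash\langle P\rangle p\leftrightarrow\langle A^*;B\rangle p$; (Con) if $P\equiv_r Q$ (restriction congruence) then $\vdash\langle P\rangle p\leftrightarrow\langle Q\rangle p$.
   Formalization: Rule (PCSub) is also taken for the right component (from P↔Q infer R|P↔R|Q); with only the left version, and no commutativity of | through (Con), preservation under | on the right fails, e.g. for a.END|(b.END|c.END) and a.END|(c.END|b.END). *)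

theory Defs
  imports Main
begin

section \<open>XCCS processes\<close>

datatype 'a act = In 'a | Out 'a | Tau

datatype 'a proc =
    Null
  | END
  | Pre "'a act" "'a proc"
  | Seq "'a proc" "'a proc"
  | Sum "'a proc" "'a proc"
  | Par "'a proc" "'a proc"
  | Star "'a proc"
  | Restr "'a proc" "'a set"

fun complementary :: "'a act \<Rightarrow> 'a act \<Rightarrow> bool" where
  "complementary (In a) (Out b) = (a = b)"
| "complementary (Out a) (In b) = (a = b)"
| "complementary _ _ = False"

fun act_names :: "'a act \<Rightarrow> 'a set" where
  "act_names (In a) = {a}"
| "act_names (Out a) = {a}"
| "act_names Tau = {}"

text \<open>\<open>ends P\<close> is the transition of \<open>P\<close> to \<open>Done\<close> under the label \<open>END\<close>, and
  \<open>step P \<alpha> Q\<close> is the transition of \<open>P\<close> to the process \<open>Q\<close> under the action \<open>\<alpha>\<close>.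
  \<open>Done\<close> is not a process and is reached under no other label.\<close>

inductive ends :: "'a proc \<Rightarrow> bool" where
  ends_END: "ends END"
| ends_Seq: "ends P \<Longrightarrow> ends Q \<Longrightarrow> ends (Seq P Q)"
| ends_Sum1: "ends P \<Longrightarrow> ends (Sum P Q)"
| ends_Sum2: "ends Q \<Longrightarrow> ends (Sum P Q)"
| ends_Par: "ends P \<Longrightarrow> ends Q \<Longrightarrow> ends (Par P Q)"
| ends_Star: "ends (Star P)"
| ends_Restr: "ends P \<Longrightarrow> ends (Restr P L)"

inductive step :: "'a proc \<Rightarrow> 'a act \<Rightarrow> 'a proc \<Rightarrow> bool" where
  step_Pre: "step (Pre \<alpha> P) \<alpha> P"
| step_Seq1: "step P \<alpha> P' \<Longrightarrow> step (Seq P Q) \<alpha> (Seq P' Q)"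
| step_Seq2: "ends P \<Longrightarrow> step Q \<alpha> Q' \<Longrightarrow> step (Seq P Q) \<alpha> Q'"
| step_Sum1: "step P \<alpha> P' \<Longrightarrow> step (Sum P Q) \<alpha> P'"
| step_Sum2: "step Q \<alpha> Q' \<Longrightarrow> step (Sum P Q) \<alpha> Q'"
| step_Par1: "step P \<alpha> P' \<Longrightarrow> step (Par P Q) \<alpha> (Par P' Q)"
| step_Par2: "step Q \<alpha> Q' \<Longrightarrow> step (Par P Q) \<alpha> (Par P Q')"
| step_Sync: "step P \<alpha> P' \<Longrightarrow> step Q \<beta> Q' \<Longrightarrow> complementary \<alpha> \<beta>
    \<Longrightarrow> step (Par P Q) Tau (Par P' Q')"
| step_Star: "step P \<alpha> P' \<Longrightarrow> step (Star P) \<alpha> (Seq P' (Star P))"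
| step_Restr: "step P \<alpha> P' \<Longrightarrow> act_names \<alpha> \<inter> L = {} \<Longrightarrow> step (Restr P L) \<alpha> (Restr P' L)"

fun unrestricted :: "'a proc \<Rightarrow> bool" where
  "unrestricted Null = True"
| "unrestricted END = True"
| "unrestricted (Pre \<alpha> P) = unrestricted P"
| "unrestricted (Seq P Q) = (unrestricted P \<and> unrestricted Q)"
| "unrestricted (Sum P Q) = (unrestricted P \<and> unrestricted Q)"
| "unrestricted (Par P Q) = (unrestricted P \<and> unrestricted Q)"
| "unrestricted (Star P) = unrestricted P"
| "unrestricted (Restr P L) = False"

fun par_free :: "'a proc \<Rightarrow> bool" where
  "par_free Null = True"
| "par_free END = True"
| "par_free (Pre \<alpha> P) = par_free P"
| "par_free (Seq P Q) = (par_free P \<and> par_free Q)"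
| "par_free (Sum P Q) = (par_free P \<and> par_free Q)"
| "par_free (Par P Q) = False"
| "par_free (Star P) = par_free P"
| "par_free (Restr P L) = par_free P"

fun sum_proc :: "'a proc list \<Rightarrow> 'a proc" where
  "sum_proc [] = Null"
| "sum_proc [P] = P"
| "sum_proc (P # Q # Ps) = Sum P (sum_proc (Q # Ps))"

text \<open>The summands of an indexed sum come in no particular order, so \<open>Exp(P1 | P2)\<close> is a
  relation: \<open>is_Exp P1 P2 E\<close> says that \<open>E\<close> is this sum for some enumeration of the summands.\<close>

definition is_Exp :: "'a proc \<Rightarrow> 'a proc \<Rightarrow> 'a proc \<Rightarrow> bool" where
  "is_Exp P1 P2 E \<longleftrightarrow> (\<exists>xs ys zs.
     distinct xs \<and> set xs = {Pre \<alpha> (Par P1' P2) |\<alpha> P1'. step P1 \<alpha> P1'} \<and>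
     distinct ys \<and> set ys = {Pre \<beta> (Par P1 P2') |\<beta> P2'. step P2 \<beta> P2'} \<and>
     distinct zs \<and> set zs = {Pre Tau (Par P1' P2') |P1' P2'.
        \<exists>\<alpha> \<beta>. step P1 \<alpha> P1' \<and> step P2 \<beta> P2' \<and> complementary \<alpha> \<beta>} \<and>
     E = Sum (Sum (Sum (sum_proc xs) (sum_proc ys)) (sum_proc zs))
           (if ends P1 \<and> ends P2 then END else Null))"


section \<open>Formulas\<close>

text \<open>Besides processes, a bare action may label a modality: \<open>Pr\<close> below has \<open>\<langle>\<alpha>\<rangle>\<close> on its right-hand
  side. The box is primitive and the diamond its dual. With the diamond primitive, \<open>K\<close>, \<open>Du\<close>
  and \<open>Gen\<close> alone would not yield replacement of equivalents under a diamond.\<close>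

datatype 'a modality = MAct "'a act" | MProc "'a proc"

datatype ('a, 'v) fm =
    Atom 'v
  | Top
  | Neg "('a, 'v) fm"
  | Conj "('a, 'v) fm" "('a, 'v) fm"
  | Box "'a modality" "('a, 'v) fm"

abbreviation Disj :: "('a, 'v) fm \<Rightarrow> ('a, 'v) fm \<Rightarrow> ('a, 'v) fm" where
  "Disj \<phi> \<psi> \<equiv> Neg (Conj (Neg \<phi>) (Neg \<psi>))"

abbreviation Impl :: "('a, 'v) fm \<Rightarrow> ('a, 'v) fm \<Rightarrow> ('a, 'v) fm" where
  "Impl \<phi> \<psi> \<equiv> Neg (Conj \<phi> (Neg \<psi>))"

abbreviation Iff :: "('a, 'v) fm \<Rightarrow> ('a, 'v) fm \<Rightarrow> ('a, 'v) fm" where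
  "Iff \<phi> \<psi> \<equiv> Conj (Impl \<phi> \<psi>) (Impl \<psi> \<phi>)"

abbreviation Dia :: "'a modality \<Rightarrow> ('a, 'v) fm \<Rightarrow> ('a, 'v) fm" where
  "Dia m \<phi> \<equiv> Neg (Box m (Neg \<phi>))"

abbreviation box :: "'a proc \<Rightarrow> ('a, 'v) fm \<Rightarrow> ('a, 'v) fm" where
  "box P \<equiv> Box (MProc P)"

abbreviation dia :: "'a proc \<Rightarrow> ('a, 'v) fm \<Rightarrow> ('a, 'v) fm" where
  "dia P \<phi> \<equiv> Dia (MProc P) \<phi>"

fun subst :: "('v \<Rightarrow> ('a, 'v) fm) \<Rightarrow> ('a, 'v) fm \<Rightarrow> ('a, 'v) fm" where
  "subst \<sigma> (Atom x) = \<sigma> x"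
| "subst \<sigma> Top = Top"
| "subst \<sigma> (Neg \<phi>) = Neg (subst \<sigma> \<phi>)"
| "subst \<sigma> (Conj \<phi> \<psi>) = Conj (subst \<sigma> \<phi>) (subst \<sigma> \<psi>)"
| "subst \<sigma> (Box m \<phi>) = Box m (subst \<sigma> \<phi>)"

text \<open>Boolean evaluation in which boxed formulas count as propositional atoms.\<close>

fun bool_eval :: "(('a, 'v) fm \<Rightarrow> bool) \<Rightarrow> ('a, 'v) fm \<Rightarrow> bool" where
  "bool_eval v (Atom x) = v (Atom x)"
| "bool_eval v Top = True"
| "bool_eval v (Neg \<phi>) = (\<not> bool_eval v \<phi>)"
| "bool_eval v (Conj \<phi> \<psi>) = (bool_eval v \<phi> \<and> bool_eval v \<psi>)"
| "bool_eval v (Box m \<phi>) = v (Box m \<phi>)"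

definition tautology :: "('a, 'v) fm \<Rightarrow> bool" where
  "tautology \<phi> \<longleftrightarrow> (\<forall>v. bool_eval v \<phi>)"


section \<open>The axiom system\<close>

text \<open>The parameter \<open>cong_r\<close> stands for the restriction congruence used in the rule \<open>Con\<close>; it is left
  arbitrary.

  Axioms are given as schemes over formulas. In \<open>PCSub\<close>, \<open>RSub\<close> and \<open>Ard\<close>, however, \<open>p\<close> must be
  a proposition letter: for arbitrary formulas these rules are unsound. For example,
  \<open>\<langle>(a.END)*\<rangle>Top\<close> and \<open>\<langle>END\<rangle>Top\<close> are equivalent, but composing both processes with a
  process that performs the complement of \<open>a\<close> separates them.

  Parallel composition is understood as unordered, so \<open>PCSub\<close> applies to either component;
  \<open>PCSub'\<close> is its mirror image.\<close>

inductive prov :: "('a proc \<Rightarrow> 'a proc \<Rightarrow> bool) \<Rightarrow> ('a, 'v) fm \<Rightarrow> bool"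
  for cong_r :: "'a proc \<Rightarrow> 'a proc \<Rightarrow> bool"
where
  Taut: "tautology \<phi> \<Longrightarrow> prov cong_r \<phi>"
| K: "prov cong_r (Impl (Box m (Impl \<phi> \<psi>)) (Impl (Box m \<phi>) (Box m \<psi>)))"
| Du: "prov cong_r (Iff (Box m \<phi>) (Neg (Dia m (Neg \<phi>))))"
| Pr: "prov cong_r (Iff (dia (Pre \<alpha> P) \<phi>) (Dia (MAct \<alpha>) (dia P \<phi>)))"
| NC: "prov cong_r (Iff (dia (Sum P1 P2) \<phi>) (Disj (dia P1 \<phi>) (dia P2 \<phi>)))"
| PC: "unrestricted (Par P1 P2) \<Longrightarrow> par_free P1 \<Longrightarrow> par_free P2 \<Longrightarrow> is_Exp P1 P2 E
    \<Longrightarrow> prov cong_r (Iff (dia (Par P1 P2) \<phi>) (dia E \<phi>))"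
| Zero: "prov cong_r (Neg (dia Null \<phi>))"
| End: "prov cong_r (Iff (dia END \<phi>) \<phi>)"
| SC: "prov cong_r (Iff (dia (Seq P1 P2) \<phi>) (dia P1 (dia P2 \<phi>)))"
| Rec: "prov cong_r (Iff (dia (Star P) \<phi>) (Disj \<phi> (dia P (dia (Star P) \<phi>))))"
| FP: "prov cong_r
    (Impl (Conj \<phi> (box (Star P) (Impl \<phi> (box P \<phi>)))) (box (Star P) \<phi>))"
| Sub: "prov cong_r \<phi> \<Longrightarrow> prov cong_r (subst \<sigma> \<phi>)"
| MP: "prov cong_r \<phi> \<Longrightarrow> prov cong_r (Impl \<phi> \<psi>) \<Longrightarrow> prov cong_r \<psi>"
| Gen: "prov cong_r \<phi> \<Longrightarrow> prov cong_r (Box m \<phi>)"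
| PCSub: "prov cong_r (Iff (dia P (Atom p)) (dia Q (Atom p)))
    \<Longrightarrow> prov cong_r (Iff (dia (Par P R) (Atom p)) (dia (Par Q R) (Atom p)))"
| PCSub': "prov cong_r (Iff (dia P (Atom p)) (dia Q (Atom p)))
    \<Longrightarrow> prov cong_r (Iff (dia (Par R P) (Atom p)) (dia (Par R Q) (Atom p)))"
| RSub: "prov cong_r (Iff (dia P (Atom p)) (dia Q (Atom p)))
    \<Longrightarrow> prov cong_r (Iff (dia (Restr P L) (Atom p)) (dia (Restr Q L) (Atom p)))"
| Ard: "prov cong_r (Iff (dia P (Atom p)) (dia (Sum (Seq A P) B) (Atom p))) \<Longrightarrow> \<not> ends A
    \<Longrightarrow> prov cong_r (Iff (dia P (Atom p)) (dia (Seq (Star A) B) (Atom p)))"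
| Con: "cong_r P Q \<Longrightarrow> prov cong_r (Iff (dia P \<phi>) (dia Q \<phi>))"

definition prov_equiv ::
    "('a proc \<Rightarrow> 'a proc \<Rightarrow> bool) \<Rightarrow> 'v \<Rightarrow> 'a proc \<Rightarrow> 'a proc \<Rightarrow> bool" where
  "prov_equiv cong_r p P Q \<longleftrightarrow> prov cong_r (Iff (dia P (Atom p)) (dia Q (Atom p)))"

definition xccs_congruence :: "('a proc \<Rightarrow> 'a proc \<Rightarrow> bool) \<Rightarrow> bool" where
  "xccs_congruence E \<longleftrightarrow> equivp E \<and>
     (\<forall>\<alpha> P Q. E P Q \<longrightarrow> E (Pre \<alpha> P) (Pre \<alpha> Q)) \<and>
     (\<forall>P Q P' Q'. E P Q \<longrightarrow> E P' Q' \<longrightarrow> E (Seq P P') (Seq Q Q')) \<and>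
     (\<forall>P Q P' Q'. E P Q \<longrightarrow> E P' Q' \<longrightarrow> E (Sum P P') (Sum Q Q')) \<and>
     (\<forall>P Q P' Q'. E P Q \<longrightarrow> E P' Q' \<longrightarrow> E (Par P P') (Par Q Q')) \<and>
     (\<forall>P Q. E P Q \<longrightarrow> E (Star P) (Star Q)) \<and>
     (\<forall>P Q L. E P Q \<longrightarrow> E (Restr P L) (Restr Q L))"

end

theory Submission
  imports Defs
begin

text \<open>By the substitution rule, provable equivalence at one proposition letter gives it at every
  formula, so the axioms \<open>Pr\<close>, \<open>SC\<close> and \<open>NC\<close> together with replacement of equivalents under
  modalities settle prefix, sequence and sum; \<open>PCSub\<close> and \<open>RSub\<close> are the cases of parallel
  composition and restriction. For the star, \<open>\<not>\<langle>Q*\<rangle>p\<close> is, by \<open>Rec\<close>, an invariant of \<open>Q\<close>, hence of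
  the equivalent process \<open>P\<close>; the induction axiom \<open>FP\<close> then yields \<open>\<not>\<langle>Q*\<rangle>p \<rightarrow> [P*]\<not>p\<close>.\<close>

text \<open>Premises move one by one into the goal as antecedents of \<open>Impl\<close> and are
  discharged by \<open>MP\<close>; what remains is a tautology. Propositional steps thereby reduce
  to Boolean reasoning with boxes as atoms.\<close>

lemma prov_conseq:
  assumes "\<And>\<phi>. \<phi> \<in> set \<Gamma> \<Longrightarrow> prov cong_r \<phi>"
    and "\<And>v. (\<And>\<phi>. \<phi> \<in> set \<Gamma> \<Longrightarrow> bool_eval v \<phi>) \<Longrightarrow> bool_eval v \<psi>"
  shows "prov cong_r \<psi>"
  using assms
proof (induction \<Gamma> arbitrary: \<psi>)
  case Nil
  then show ?case by (simp add: Taut tautology_def)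
next
  case (Cons \<gamma> \<Gamma>)
  have "prov cong_r (Impl \<gamma> \<psi>)"
  proof (rule Cons.IH)
    show "bool_eval v (Impl \<gamma> \<psi>)" if "\<And>\<phi>. \<phi> \<in> set \<Gamma> \<Longrightarrow> bool_eval v \<phi>" for v
      using Cons.prems(2)[of v] that by auto
  qed (simp add: Cons.prems(1))
  moreover have "prov cong_r \<gamma>"
    by (simp add: Cons.prems(1))
  ultimately show ?case by (rule MP[rotated])
qed

lemma prov_conseq1:
  assumes "prov cong_r \<phi>" "\<And>v. bool_eval v \<phi> \<Longrightarrow> bool_eval v \<psi>"
  shows "prov cong_r \<psi>"
  by (rule prov_conseq[of "[\<phi>]"]) (use assms in auto)

lemma prov_conseq2:
  assumes "prov cong_r \<phi>" "prov cong_r \<chi>"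
    and "\<And>v. bool_eval v \<phi> \<Longrightarrow> bool_eval v \<chi> \<Longrightarrow> bool_eval v \<psi>"
  shows "prov cong_r \<psi>"
  by (rule prov_conseq[of "[\<phi>, \<chi>]"]) (use assms in auto)

lemma prov_Iff_refl: "prov cong_r (Iff \<phi> \<phi>)"
  by (simp add: Taut tautology_def)

lemma prov_Iff_sym: "prov cong_r (Iff \<phi> \<psi>) \<Longrightarrow> prov cong_r (Iff \<psi> \<phi>)"
  by (erule prov_conseq1) (unfold bool_eval.simps, blast)

lemma prov_Iff_trans [trans]:
  "prov cong_r (Iff \<phi> \<psi>) \<Longrightarrow> prov cong_r (Iff \<psi> \<chi>) \<Longrightarrow> prov cong_r (Iff \<phi> \<chi>)"
  by (erule (1) prov_conseq2) (unfold bool_eval.simps, blast)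

lemma prov_Box_mono:
  assumes "prov cong_r (Impl \<phi> \<psi>)"
  shows "prov cong_r (Impl (Box m \<phi>) (Box m \<psi>))"
  using Gen[OF assms] K by (rule MP)

text \<open>A diamond is a negated box of a negation, so this is box monotonicity contraposed inside
  and outside the modality.\<close>

lemma prov_Dia_mono:
  assumes "prov cong_r (Impl \<phi> \<psi>)"
  shows "prov cong_r (Impl (Dia m \<phi>) (Dia m \<psi>))"
proof -
  have "prov cong_r (Impl (Neg \<psi>) (Neg \<phi>))"
    using assms by (rule prov_conseq1) (unfold bool_eval.simps, blast)
  then show ?thesis
    by (rule prov_conseq1[OF prov_Box_mono[of _ _ _ m]]) (unfold bool_eval.simps, blast)
qed

lemma prov_Dia_cong:
  assumes "prov cong_r (Iff \<phi> \<psi>)"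
  shows "prov cong_r (Iff (Dia m \<phi>) (Dia m \<psi>))"
proof -
  have "prov cong_r (Impl \<phi> \<psi>)"
    using assms by (rule prov_conseq1) (unfold bool_eval.simps, blast)
  moreover have "prov cong_r (Impl \<psi> \<phi>)"
    using assms by (rule prov_conseq1) (unfold bool_eval.simps, blast)
  ultimately show ?thesis
    by (rule prov_conseq2[OF prov_Dia_mono[of _ _ _ m] prov_Dia_mono[of _ _ _ m]]) (unfold bool_eval.simps, blast)
qed

lemma prov_equiv_formula:
  fixes p :: 'v and \<phi> :: "('a, 'v) fm"
  assumes "prov_equiv cong_r p P Q"
  shows "prov cong_r (Iff (dia P \<phi>) (dia Q \<phi>))"
  \<comment> \<open>A constant substitution suffices: \<open>p\<close> is the only letter present,
    and processes contain none.\<close>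
  using Sub[OF assms[unfolded prov_equiv_def], of "\<lambda>_. \<phi>"] by simp

text \<open>The assumption ranges over all formulas because it is applied to
  \<open>dia (Star Q)\<close> of the given formula.\<close>

lemma prov_dia_Star_mono:
  fixes \<phi> :: "('a, 'v) fm"
  assumes "\<And>\<phi> :: ('a, 'v) fm. prov cong_r (Iff (dia P \<phi>) (dia Q \<phi>))"
  shows "prov cong_r (Impl (dia (Star P) \<phi>) (dia (Star Q) \<phi>))"
proof -
  let ?\<chi> = "dia (Star Q) \<phi>"
  \<comment> \<open>\<open>dia P ?\<chi>\<close> gives \<open>dia Q ?\<chi>\<close>, which gives
    \<open>?\<chi>\<close> by the second disjunct of \<open>Rec\<close>; contrapose.\<close>
  have "prov cong_r (Impl (Neg ?\<chi>) (box P (Neg ?\<chi>)))"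
    by (rule prov_conseq2[OF Rec[of cong_r Q \<phi>] assms[of ?\<chi>]]) (unfold bool_eval.simps, blast)
  then have "prov cong_r (box (Star P) (Impl (Neg ?\<chi>) (box P (Neg ?\<chi>))))"
    by (rule Gen)
  then have invariant: "prov cong_r (Impl (Neg ?\<chi>) (box (Star P) (Neg ?\<chi>)))"
    by (rule prov_conseq2[OF _ FP[of cong_r "Neg ?\<chi>" P]]) (unfold bool_eval.simps, blast)
  \<comment> \<open>This contraposes the first disjunct of \<open>Rec\<close>.\<close>
  have "prov cong_r (Impl (Neg ?\<chi>) (Neg \<phi>))"
    by (rule prov_conseq1[OF Rec[of cong_r Q \<phi>]]) (unfold bool_eval.simps, blast)
  then have "prov cong_r (Impl (box (Star P) (Neg ?\<chi>)) (box (Star P) (Neg \<phi>)))"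
    by (rule prov_Box_mono)
  with invariant show ?thesis
    by (rule prov_conseq2) (unfold bool_eval.simps, blast)
qed

lemma equivp_prov_equiv: "equivp (prov_equiv cong_r p)"
proof (rule equivpI)
  show "reflp (prov_equiv cong_r p)"
    by (rule reflpI) (simp only: prov_equiv_def prov_Iff_refl)
  show "symp (prov_equiv cong_r p)"
    by (rule sympI) (unfold prov_equiv_def, erule prov_Iff_sym)
  show "transp (prov_equiv cong_r p)"
    by (rule transpI) (unfold prov_equiv_def, erule (1) prov_Iff_trans)
qed

lemma prov_equiv_trans:
  "prov_equiv cong_r p P Q \<Longrightarrow> prov_equiv cong_r p Q R \<Longrightarrow> prov_equiv cong_r p P R"
  by (rule equivp_transp[OF equivp_prov_equiv])

lemma prov_equiv_Pre:
  assumes "prov_equiv cong_r p P Q"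
  shows "prov_equiv cong_r p (Pre \<alpha> P) (Pre \<alpha> Q)"
  unfolding prov_equiv_def
proof -
  note Pr[of cong_r \<alpha> P "Atom p"]
  also note prov_Dia_cong[OF assms[unfolded prov_equiv_def]]
  also note prov_Iff_sym[OF Pr]
  finally show "prov cong_r (Iff (dia (Pre \<alpha> P) (Atom p)) (dia (Pre \<alpha> Q) (Atom p)))" .
qed

lemma prov_equiv_Seq:
  assumes "prov_equiv cong_r p P Q" "prov_equiv cong_r p P' Q'"
  shows "prov_equiv cong_r p (Seq P P') (Seq Q Q')"
  unfolding prov_equiv_def
proof -
  note SC[of cong_r P P' "Atom p"]
  \<comment> \<open>Here \<open>P\<close> acts on \<open>dia P' (Atom p)\<close>, so equivalence at
    the letter alone would not do.\<close>
  also note prov_equiv_formula[OF assms(1)]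
  also note prov_Dia_cong[OF assms(2)[unfolded prov_equiv_def]]
  also note prov_Iff_sym[OF SC]
  finally show "prov cong_r (Iff (dia (Seq P P') (Atom p)) (dia (Seq Q Q') (Atom p)))" .
qed

lemma prov_equiv_Sum:
  assumes "prov_equiv cong_r p P Q" "prov_equiv cong_r p P' Q'"
  shows "prov_equiv cong_r p (Sum P P') (Sum Q Q')"
  unfolding prov_equiv_def
proof -
  note NC[of cong_r P P' "Atom p"]
  also have "prov cong_r (Iff (Disj (dia P (Atom p)) (dia P' (Atom p)))
      (Disj (dia Q (Atom p)) (dia Q' (Atom p))))"
    by (rule prov_conseq2[OF assms[unfolded prov_equiv_def]]) (unfold bool_eval.simps, blast)
  also note prov_Iff_sym[OF NC]
  finally show "prov cong_r (Iff (dia (Sum P P') (Atom p)) (dia (Sum Q Q') (Atom p)))" .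
qed

text \<open>\<open>PCSub\<close> and \<open>PCSub'\<close> each change one component, so the
  replacement passes through \<open>Par Q P'\<close>.\<close>

lemma prov_equiv_Par:
  assumes "prov_equiv cong_r p P Q" "prov_equiv cong_r p P' Q'"
  shows "prov_equiv cong_r p (Par P P') (Par Q Q')"
proof (rule prov_equiv_trans)
  show "prov_equiv cong_r p (Par P P') (Par Q P')"
    using assms(1) unfolding prov_equiv_def by (rule PCSub)
  show "prov_equiv cong_r p (Par Q P') (Par Q Q')"
    using assms(2) unfolding prov_equiv_def by (rule PCSub')
qed

lemma prov_equiv_Star:
  fixes cong_r :: "'a proc \<Rightarrow> 'a proc \<Rightarrow> bool" and p :: 'v
  assumes "prov_equiv cong_r p P Q"
  shows "prov_equiv cong_r p (Star P) (Star Q)"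
proof -
  have PQ: "prov cong_r (Iff (dia P \<phi>) (dia Q \<phi>))" for \<phi> :: "('a, 'v) fm"
    using assms by (rule prov_equiv_formula)
  show ?thesis
    unfolding prov_equiv_def
    \<comment> \<open>The two implications come from monotonicity with \<open>P\<close> and
      \<open>Q\<close> exchanged.\<close>
    by (rule prov_conseq2[OF prov_dia_Star_mono[OF PQ]
          prov_dia_Star_mono[OF prov_Iff_sym[OF PQ]]]) (unfold bool_eval.simps, blast)
qed

lemma prov_equiv_Restr:
  "prov_equiv cong_r p P Q \<Longrightarrow> prov_equiv cong_r p (Restr P L) (Restr Q L)"
  unfolding prov_equiv_def by (rule RSub)

theorem theorem5p17:
  fixes cong_r :: "'a proc \<Rightarrow> 'a proc \<Rightarrow> bool" and p :: 'v
  shows "xccs_congruence (prov_equiv cong_r p)"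
  unfolding xccs_congruence_def
  by (simp add: equivp_prov_equiv prov_equiv_Pre prov_equiv_Seq prov_equiv_Sum prov_equiv_Par
      prov_equiv_Star prov_equiv_Restr)

end
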